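(* Let $\delta=r/s$ where $r\in\mathbb N_0$ and $s\in\mathbb N$, let $p\in[0,1]$, and let $(X_t)_{t\in\mathbb N}$ be a sequence of $\mathbb N$-valued random variables. Let $(G_t)_{t\ge0}$ be the growing undirected graph generated by the (generalized) generalized linear preference model with parameters $\delta,p,(X_t)$ (defined in the context). Suppose that $\ell=\ell(n)$ and $u=u(n)$ are positive integers such that $\ell\le X_t\le u$ for all $t\in\mathbb N$. Then there is a constant $C$, not depending on $n$, such that asymptotically almost surely (as $n\to\infty$) the diameter of $G_n$ is at most $$4e\left(\frac{u}{\ell}+\frac{\delta}{2\ell}\right)\log n+C\,u.$$
   Context: Conventions: $\mathbb N=\{1,2,\dots\}$, $\mathbb N_0=\{0,1,2,\dots\}$; $\log$ is the natural logarithm and $e$ its base. Graphs are finite and may have loops and parallel edges. The diameter is the maximum distance between two vertices. The initial graph $G_0$ is finite of size $O(1)$ (bounded independently of $n$). "Asymptotically almost surely" means with probability tending to $1$ as $n\to\infty$. Random choices at time $t$ have the stated distributions conditionally on the history of the process up to time $t-1$ and on the value $X_t$. For an undirected graph $G$ and $\delta>-1$, $\rho_\delta$ is the probability distribution on $V(G)$ given by $\rho_\delta(v)=(\deg(v)+\delta)/\sum_{u\in V(G)}(\deg(u)+\delta)$, where a loop is counted twice in the degree. Model: $G_0$ is an arbitrary connected graph with at least one edge. At each time-step $t\in\mathbb N$, exactly one of the following operations is applied to $G_{t-1}$ to obtain $G_t$: operation (a) with probability $p$ and operation (b) with probability $1-p$. (a) Sample $X_t$ vertices of $G_{t-1}$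 independently using $\rho_\delta$, then add a new vertex $v$ and join it to the sampled vertices. (b) Sample $2X_t$ vertices $W_1,W_1',\dots,W_{X_t},W_{X_t}'$ of $G_{t-1}$ independently using $\rho_\delta$, then add the edges $W_1W_1',\dots,W_{X_t}W_{X_t}'$. *)

theory Defs
  imports "HOL-Probability.Probability" "HOL-Library.Uprod"
begin

section \<open>Finite undirected multigraphs\<close>

text \<open>An edge is the unordered pair of its endpoints, so \<open>Upair v v\<close> is a loop at \<open>v\<close>;
  parallel edges are multiple occurrences of the same pair.\<close>

record 'v multigraph =
  verts :: "'v set"
  edges :: "'v uprod multiset"

definition wf_multigraph :: "'v multigraph \<Rightarrow> bool" where
  "wf_multigraph G \<longleftrightarrow> finite (verts G) \<and> (\<forall>e \<in># edges G. set_uprod e \<subseteq> verts G)"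

text \<open>The second summand makes loops count twice.\<close>

definition degree :: "'v multigraph \<Rightarrow> 'v \<Rightarrow> nat" where
  "degree G v = size {#e \<in># edges G. v \<in> set_uprod e#} + size {#e \<in># edges G. e = Upair v v#}"

definition adjacent :: "'v multigraph \<Rightarrow> 'v \<Rightarrow> 'v \<Rightarrow> bool" where
  "adjacent G v w \<longleftrightarrow> Upair v w \<in># edges G"

definition connected_graph :: "'v multigraph \<Rightarrow> bool" where
  "connected_graph G \<longleftrightarrow>
     verts G \<noteq> {} \<and> (\<forall>v \<in> verts G. \<forall>w \<in> verts G. (adjacent G)\<^sup>*\<^sup>* v w)"

text \<open>\<open>(adjacent G ^^ k) v w\<close> says that there is a walk with \<open>k\<close> edges from \<open>v\<close> to \<open>w\<close>. The
  distance of vertices in different components is \<open>\<infinity>\<close>.\<close>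

definition distance :: "'v multigraph \<Rightarrow> 'v \<Rightarrow> 'v \<Rightarrow> enat" where
  "distance G v w = (INF k \<in> {k. (adjacent G ^^ k) v w}. enat k)"

definition graph_diameter :: "'v multigraph \<Rightarrow> enat" where
  "graph_diameter G = (SUP (v, w) \<in> verts G \<times> verts G. distance G v w)"


section \<open>The generalized linear preference model\<close>

definition rho :: "real \<Rightarrow> 'v multigraph \<Rightarrow> 'v pmf" where
  "rho \<delta> G = embed_pmf (\<lambda>v. if v \<in> verts G
     then (real (degree G v) + \<delta>) / (\<Sum>u \<in> verts G. (real (degree G u) + \<delta>)) else 0)"

text \<open>\<open>embed_pmf\<close> is only meaningful when its argument is a probability mass function. This is the
  case for every connected graph with an edge and \<open>\<delta> > -1\<close>, since then all degrees are positive.\<close>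

lemma pmf_rho:
  assumes "finite (verts G)" "\<And>v. v \<in> verts G \<Longrightarrow> real (degree G v) + \<delta> \<ge> 0"
    and "(\<Sum>u \<in> verts G. (real (degree G u) + \<delta>)) > 0"
  shows "pmf (rho \<delta> G) v =
    (if v \<in> verts G then (real (degree G v) + \<delta>) / (\<Sum>u \<in> verts G. (real (degree G u) + \<delta>)) else 0)"
proof -
  let ?S = "\<Sum>u \<in> verts G. real (degree G u) + \<delta>"
  let ?f = "\<lambda>v. if v \<in> verts G then (real (degree G v) + \<delta>) / ?S else 0"
  have nonneg: "?f x \<ge> 0" for x
    using assms(2)[of x] assms(3) by (simp del: sum.distrib)
  have "(\<integral>\<^sup>+x. ennreal (?f x) \<partial>count_space UNIV) = (\<Sum>x \<in> verts G. ennreal (?f x))"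
    by (rule nn_integral_count_space'[OF assms(1)]) auto
  also have "\<dots> = ennreal (\<Sum>x \<in> verts G. ?f x)"
    using nonneg by (intro sum_ennreal) blast
  also have "(\<Sum>x \<in> verts G. ?f x) = (\<Sum>x \<in> verts G. (real (degree G x) + \<delta>) / ?S)"
    by (intro sum.cong) auto
  also have "\<dots> = ?S / ?S"
    by (rule sum_divide_distrib[symmetric])
  also have "\<dots> = 1"
    using assms(3) by (intro divide_self) linarith
  finally have "(\<integral>\<^sup>+x. ennreal (?f x) \<partial>count_space UNIV) = 1"
    by simp
  then show ?thesis
    unfolding rho_def by (intro pmf_embed_pmf nonneg)
qed

text \<open>Vertices are natural numbers; the name of a vertex added by operation (a) is immaterial as
  long as it is new.\<close>

definition fresh :: "nat multigraph \<Rightarrow> nat" where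
  "fresh G = Suc (Max (verts G))"

definition join_new_vertex :: "nat list \<Rightarrow> nat multigraph \<Rightarrow> nat multigraph" where
  "join_new_vertex ws G =
     \<lparr>verts = insert (fresh G) (verts G), edges = edges G + mset (map (Upair (fresh G)) ws)\<rparr>"

definition add_edges :: "(nat \<times> nat) list \<Rightarrow> nat multigraph \<Rightarrow> nat multigraph" where
  "add_edges ps G =
     \<lparr>verts = verts G, edges = edges G + mset (map (\<lambda>(w, w'). Upair w w') ps)\<rparr>"

definition operation_a :: "real \<Rightarrow> nat \<Rightarrow> nat multigraph \<Rightarrow> nat multigraph pmf" where
  "operation_a \<delta> x G = map_pmf (\<lambda>ws. join_new_vertex ws G) (replicate_pmf x (rho \<delta> G))"

definition operation_b :: "real \<Rightarrow> nat \<Rightarrow> nat multigraph \<Rightarrow> nat multigraph pmf" where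
  "operation_b \<delta> x G =
     map_pmf (\<lambda>ps. add_edges ps G) (replicate_pmf x (pair_pmf (rho \<delta> G) (rho \<delta> G)))"

definition glp_step :: "real \<Rightarrow> real \<Rightarrow> nat \<Rightarrow> nat multigraph \<Rightarrow> nat multigraph pmf" where
  "glp_step \<delta> p x G =
     bernoulli_pmf p \<bind> (\<lambda>b. if b then operation_a \<delta> x G else operation_b \<delta> x G)"

text \<open>The joint law of the numbers \<open>X\<^sub>t\<close> and their dependence on the past are unrestricted. Only the
  law of \<open>G\<^sub>t\<close> given \<open>G\<^sub>0, \<dots>, G\<^sub>t\<^sub>-\<^sub>1\<close> and \<open>X\<^sub>1, \<dots>, X\<^sub>t\<close> is prescribed. All these variables take
  countably many values, so elementary conditional probabilities suffice. \<open>X 0\<close> is not used.\<close>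

locale glp_model = prob_space M
  for M :: "'a measure" and \<delta> p :: real and G\<^sub>0 :: "nat multigraph"
    and X :: "nat \<Rightarrow> 'a \<Rightarrow> nat" and G :: "nat \<Rightarrow> 'a \<Rightarrow> nat multigraph" +
  assumes initial: "wf_multigraph G\<^sub>0" "connected_graph G\<^sub>0" "edges G\<^sub>0 \<noteq> {#}"
    and measurable_X: "\<And>t. t \<ge> 1 \<Longrightarrow> X t \<in> measurable M (count_space UNIV)"
    and measurable_G: "\<And>t. G t \<in> measurable M (count_space UNIV)"
    and X_pos: "\<And>t \<omega>. t \<ge> 1 \<Longrightarrow> \<omega> \<in> space M \<Longrightarrow> X t \<omega> \<ge> 1"
    and start: "AE \<omega> in M. G 0 \<omega> = G\<^sub>0"
    and step: "\<And>t g x h. t \<ge> 1 \<Longrightarrow>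
      \<P>(\<omega> in M. (\<forall>i<t. G i \<omega> = g i) \<and> (\<forall>i\<in>{1..t}. X i \<omega> = x i)) > 0 \<Longrightarrow>
      \<P>(\<omega> in M. G t \<omega> = h \<bar> (\<forall>i<t. G i \<omega> = g i) \<and> (\<forall>i\<in>{1..t}. X i \<omega> = x i)) =
        pmf (glp_step \<delta> p (x t) (g (t - 1))) h"

end

theory Submission
  imports Defs
begin

text \<open>Fix a root \<open>r\<close> in \<open>G\<^sub>0\<close>, let \<open>d(v)\<close> be the distance from \<open>r\<close> to \<open>v\<close>, and put
  \<open>\<Phi>(G) = \<Sum>\<^sub>v (deg v + \<delta>) 2\<^bsup>d(v)\<^esup>\<close> and \<open>W(G) = \<Sum>\<^sub>v (deg v + \<delta>)\<close>. A new vertex is at most one step further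
  from \<open>r\<close> than its first neighbour, so one step with \<open>X\<^sub>t = x\<close> multiplies \<open>\<Phi>\<close> in expectation by at
  most \<open>1 + 2y/W\<close> and replaces \<open>W\<close> by \<open>W + y\<close>, where \<open>y = 2x + \<delta>\<close> for operation (a) and \<open>y = 2x\<close> for
  operation (b). As \<open>1 + 2y/W \<le> (1 + y/W)\<^sup>2\<close>, \<open>\<Phi>/W\<^sup>2\<close> is a supermartingale, whatever the values \<open>X\<^sub>t\<close>.
  Since \<open>W(G\<^sub>n) = O(u n)\<close>, Markov's inequality shows that with probability \<open>1 - O(1/n)\<close> no vertex has
  \<open>d(v) > 2 e log n + 2 u\<close>, where \<open>2 e ln 2 \<ge> 3\<close> is used. The diameter is at most twice the largest
  \<open>d(v)\<close>, and \<open>u/l \<ge> 1\<close>.\<close>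

section \<open>Degree-weighted vertex sums and their change under the two operations\<close>

lemma degree_add_edges_Cons:
  "degree (add_edges ((a, b) # ps) G) v = degree (add_edges ps G) v + of_bool (v = a) + of_bool (v = b)"
  by (auto simp: degree_def add_edges_def)

lemma verts_add_edges [simp]: "verts (add_edges ps G) = verts G"
  by (simp add: add_edges_def)

text \<open>Up to the normalising factor \<open>total_weight \<delta> G\<close>, this is the mean of
  \<open>\<phi>\<close> under \<open>rho \<delta> G\<close>; the constant function 1 gives that
  factor itself.\<close>

definition weighted_sum :: "real \<Rightarrow> 'v multigraph \<Rightarrow> ('v \<Rightarrow> real) \<Rightarrow> real" where
  "weighted_sum \<delta> G \<phi> = (\<Sum>v\<in>verts G. (real (degree G v) + \<delta>) * \<phi> v)"

abbreviation total_weight :: "real \<Rightarrow> 'v multigraph \<Rightarrow> real" where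
  "total_weight \<delta> G \<equiv> weighted_sum \<delta> G (\<lambda>_. 1)"

text \<open>Intermediate stage of operation (a): once the new vertex is present without edges,
  joining it is an instance of \<open>add_edges\<close>, so one computation serves both
  operations.\<close>

definition add_isolated_vertex :: "nat multigraph \<Rightarrow> nat multigraph" where
  "add_isolated_vertex G = \<lparr>verts = insert (fresh G) (verts G), edges = edges G\<rparr>"

lemma join_new_vertex_eq_add_edges:
  "join_new_vertex ws G = add_edges (map (Pair (fresh G)) ws) (add_isolated_vertex G)"
  by (simp add: join_new_vertex_def add_edges_def add_isolated_vertex_def comp_def)

lemma fresh_notin: "finite (verts G) \<Longrightarrow> fresh G \<notin> verts G"
  unfolding fresh_def using Max_ge Suc_n_not_le_n by blast

text \<open>Each new edge raises the degree of either endpoint by one. A loop \<open>(a, a)\<close>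
  contributes \<open>\<phi> a\<close> twice, in agreement with loops counting twice in the
  degree.\<close>

lemma weighted_sum_add_edges:
  assumes "finite (verts G)" "set ps \<subseteq> verts G \<times> verts G"
  shows "weighted_sum \<delta> (add_edges ps G) \<phi> =
    weighted_sum \<delta> G \<phi> + (\<Sum>(a, b)\<leftarrow>ps. \<phi> a + \<phi> b)"
  using assms(2)
proof (induction ps)
  case Nil
  then show ?case by (simp add: add_edges_def weighted_sum_def degree_def)
next
  case (Cons q ps)
  obtain a b where q: "q = (a, b)" by (cases q)
  have ab: "a \<in> verts G" "b \<in> verts G" using Cons.prems q by auto
  have "weighted_sum \<delta> (add_edges (q # ps) G) \<phi> =
     (\<Sum>v\<in>verts G. (real (degree (add_edges ps G) v) + \<delta>) * \<phi> v
        + (of_bool (v = a) * \<phi> v + of_bool (v = b) * \<phi> v))"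
    unfolding weighted_sum_def q by (auto simp: degree_add_edges_Cons algebra_simps intro!: sum.cong)
  also have "\<dots> = weighted_sum \<delta> (add_edges ps G) \<phi> + (\<phi> a + \<phi> b)"
    using ab assms(1) by (simp add: sum.distrib weighted_sum_def of_bool_def if_distrib[of "\<lambda>x. x * _"] cong: if_cong)
  finally show ?case using Cons by (simp add: q)
qed

lemma degree_notin_verts:
  "wf_multigraph G \<Longrightarrow> v \<notin> verts G \<Longrightarrow> degree G v = 0"
  by (fastforce simp: wf_multigraph_def degree_def filter_mset_eq_conv)

text \<open>The new vertex has degree 0 but still carries the weight \<open>\<delta>\<close>.
  Well-formedness excludes stray edges that already contain the fresh name.\<close>

lemma weighted_sum_add_isolated_vertex:
  assumes "wf_multigraph G"
  shows "weighted_sum \<delta> (add_isolated_vertex G) \<phi> = weighted_sum \<delta> G \<phi> + \<delta> * \<phi> (fresh G)"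
proof -
  have "finite (verts G)" using assms by (simp add: wf_multigraph_def)
  moreover have "degree (add_isolated_vertex G) v = degree G v" for v
    by (simp add: degree_def add_isolated_vertex_def)
  ultimately show ?thesis
    using degree_notin_verts[OF assms fresh_notin] fresh_notin[of G]
    by (simp add: weighted_sum_def add_isolated_vertex_def)
qed

lemma weighted_sum_join_new_vertex:
  assumes "wf_multigraph G" "set ws \<subseteq> verts G"
  shows "weighted_sum \<delta> (join_new_vertex ws G) \<phi> =
    weighted_sum \<delta> G \<phi> + (real (length ws) + \<delta>) * \<phi> (fresh G) + (\<Sum>w\<leftarrow>ws. \<phi> w)"
proof -
  have "finite (verts (add_isolated_vertex G))"
    using assms by (simp add: wf_multigraph_def add_isolated_vertex_def)
  then have "weighted_sum \<delta> (join_new_vertex ws G) \<phi> =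
      weighted_sum \<delta> G \<phi> + \<delta> * \<phi> (fresh G)
        + (\<Sum>(a, b)\<leftarrow>map (Pair (fresh G)) ws. \<phi> a + \<phi> b)"
    unfolding join_new_vertex_eq_add_edges
    using assms by (subst weighted_sum_add_edges)
      (auto simp: add_isolated_vertex_def weighted_sum_add_isolated_vertex[unfolded add_isolated_vertex_def])
  also have "(\<Sum>(a, b)\<leftarrow>map (Pair (fresh G)) ws. \<phi> a + \<phi> b) = real (length ws) * \<phi> (fresh G) + (\<Sum>w\<leftarrow>ws. \<phi> w)"
    by (induction ws) (auto simp: algebra_simps)
  finally show ?thesis by (simp add: algebra_simps)
qed

lemma weighted_sum_mono:
  assumes "\<delta> \<ge> 0" "\<And>v. v \<in> verts G \<Longrightarrow> \<phi> v \<le> \<psi> v"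
  shows "weighted_sum \<delta> G \<phi> \<le> weighted_sum \<delta> G \<psi>"
  unfolding weighted_sum_def using assms by (intro sum_mono mult_left_mono) auto

lemma weighted_sum_cmult: "weighted_sum \<delta> G (\<lambda>v. c * \<phi> v) = c * weighted_sum \<delta> G \<phi>"
  by (simp add: weighted_sum_def sum_distrib_left algebra_simps)

lemma weighted_sum_cong:
  "(\<And>v. v \<in> verts G \<Longrightarrow> \<phi> v = \<psi> v) \<Longrightarrow> weighted_sum \<delta> G \<phi> = weighted_sum \<delta> G \<psi>"
  by (simp add: weighted_sum_def)

section \<open>Listing the edges: the handshake identity and countability of the state space\<close>

lemma ex_edges_list: "\<exists>ps. edges G = mset (map (\<lambda>(a, b). Upair a b) ps)"
proof -
  obtain es where "edges G = mset es" using ex_mset by metis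
  moreover have "\<exists>ps. es = map (\<lambda>(a, b). Upair a b) ps"
  proof (induction es)
    case (Cons e es)
    then obtain ps where "es = map (\<lambda>(a, b). Upair a b) ps" by blast
    moreover obtain a b where "e = Upair a b" by (cases e)
    ultimately show ?case by (intro exI[of _ "(a, b) # ps"]) auto
  qed simp
  ultimately show ?thesis by metis
qed

text \<open>Handshake identity: the graph is rebuilt from the edgeless graph on its vertices, and
  each added edge contributes 1 + 1.\<close>

lemma total_weight_eq:
  fixes G :: "nat multigraph"
  assumes "wf_multigraph G"
  shows "total_weight \<delta> G = 2 * real (size (edges G)) + \<delta> * real (card (verts G))"
proof -
  obtain ps where ps: "edges G = mset (map (\<lambda>(a, b). Upair a b) ps)"
    using ex_edges_list by blast
  let ?H = "\<lparr>verts = verts G, edges = {#}\<rparr>"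
  have sub: "set ps \<subseteq> verts G \<times> verts G"
    using assms by (fastforce simp: wf_multigraph_def ps)
  have "G = add_edges ps ?H" unfolding add_edges_def ps[symmetric] by simp
  then have "total_weight \<delta> G = total_weight \<delta> (add_edges ps ?H)" by simp
  also have "\<dots> = total_weight \<delta> ?H + (\<Sum>(a, b)\<leftarrow>ps. 1 + 1)"
    using assms sub by (intro weighted_sum_add_edges) (auto simp: wf_multigraph_def)
  also have "(\<Sum>(a, b)\<leftarrow>ps. 1 + 1) = 2 * real (length ps)"
    by (induction ps) auto
  also have "total_weight \<delta> ?H = \<delta> * real (card (verts G))"
    by (simp add: weighted_sum_def degree_def)
  finally show ?thesis by (simp add: ps)
qed

text \<open>A well-formed graph is coded by a finite vertex set and a list of pairs. The whole type
  is uncountable because of infinite vertex sets, so sums over histories have to be restricted to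
  well-formed graphs.\<close>

lemma countable_wf_multigraphs: "countable {G :: nat multigraph. wf_multigraph G}"
proof (rule countable_subset)
  show "{G. wf_multigraph G} \<subseteq> (\<lambda>(V :: nat set, ps). \<lparr>verts = V, edges = mset (map (\<lambda>(a, b). Upair a b) ps)\<rparr>)
      ` ({V. finite V} \<times> UNIV)" (is "_ \<subseteq> ?f ` _")
  proof
    fix G :: "nat multigraph"
    assume "G \<in> {G. wf_multigraph G}"
    moreover obtain ps where "edges G = mset (map (\<lambda>(a, b). Upair a b) ps)"
      using ex_edges_list by blast
    ultimately show "G \<in> ?f ` ({V. finite V} \<times> UNIV)"
      by (intro image_eqI[of _ _ "(verts G, ps)"]) (auto simp: wf_multigraph_def)
  qed
  show "countable (?f ` ({V :: nat set. finite V} \<times> UNIV))"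
    by (intro countable_image countable_SIGMA countable_Collect_finite) auto
qed

section \<open>Depth\<close>

text \<open>Natural-valued, unlike \<open>distance\<close>, so that it can serve as an exponent. It
  is a genuine distance only where a walk from \<open>r\<close> exists, which
  \<open>admissible\<close> guarantees for all vertices.\<close>

definition depth :: "'v \<Rightarrow> 'v multigraph \<Rightarrow> 'v \<Rightarrow> nat" where
  "depth r G v = (LEAST k. (adjacent G ^^ k) r v)"

text \<open>The invariant of the process: it makes \<open>rho\<close> a genuine distribution for
  nonnegative \<open>\<delta>\<close> and keeps all depths meaningful, with the same root
  \<open>r\<close> throughout.\<close>

definition admissible :: "'v \<Rightarrow> 'v multigraph \<Rightarrow> bool" where
  "admissible r G \<longleftrightarrow> wf_multigraph G \<and> connected_graph G \<and> edges G \<noteq> {#} \<and> r \<in> verts G"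

lemma adjacent_sym: "adjacent G v w \<Longrightarrow> adjacent G w v"
  unfolding adjacent_def by (metis Upair_inject)

lemma adjacent_relpowp_sym: "(adjacent G ^^ k) v w \<Longrightarrow> (adjacent G ^^ k) w v"
proof (induction k arbitrary: w)
  case (Suc k)
  then obtain x where "(adjacent G ^^ k) v x" "adjacent G x w" by auto
  then show ?case using Suc.IH relpowp_Suc_I2 adjacent_sym by metis
qed auto

lemma relpowp_depth:
  assumes "admissible r G" "v \<in> verts G"
  shows "(adjacent G ^^ depth r G v) r v"
  unfolding depth_def
proof (rule LeastI_ex)
  show "\<exists>k. (adjacent G ^^ k) r v"
    using assms by (metis admissible_def connected_graph_def rtranclp_imp_relpowp)
qed

lemma depth_le: "(adjacent G ^^ k) r v \<Longrightarrow> depth r G v \<le> k"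
  unfolding depth_def by (rule Least_le)

text \<open>Walk from \<open>v\<close> back to the root and then out to \<open>w\<close>.\<close>

lemma distance_le_depth_add:
  assumes "admissible r G" "v \<in> verts G" "w \<in> verts G"
  shows "distance G v w \<le> enat (depth r G v + depth r G w)"
proof -
  have "(adjacent G ^^ (depth r G v + depth r G w)) v w"
    using adjacent_relpowp_sym[OF relpowp_depth[OF assms(1,2)]] relpowp_depth[OF assms(1,3)]
    by (auto simp: relpowp_add)
  then show ?thesis unfolding distance_def by (intro INF_lower) simp
qed

lemma graph_diameter_le:
  assumes "admissible r G" "\<And>v. v \<in> verts G \<Longrightarrow> depth r G v \<le> k"
  shows "graph_diameter G \<le> enat (2 * k)"
  unfolding graph_diameter_def
proof (rule SUP_least, clarify)
  fix v w assume vw: "v \<in> verts G" "w \<in> verts G"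
  have "distance G v w \<le> enat (depth r G v + depth r G w)"
    by (rule distance_le_depth_add[OF assms(1) vw])
  also have "\<dots> \<le> enat (2 * k)" using assms(2)[OF vw(1)] assms(2)[OF vw(2)] by simp
  finally show "distance G v w \<le> enat (2 * k)" .
qed

text \<open>Over a finite relation, reachability is witnessed by a walk with at most as many steps
  as the relation has pairs, and adjacency has at most \<open>(card (verts G))\<^sup>2\<close>
  pairs. Being crude is harmless: the bound is applied only to the initial graph.\<close>

lemma depth_le_card_squared:
  assumes "admissible r G" "v \<in> verts G"
  shows "depth r G v \<le> (card (verts G))\<^sup>2"
proof -
  let ?R = "{(x, y). adjacent G x y}"
  have fin: "finite (verts G)" and sub: "?R \<subseteq> verts G \<times> verts G"
    using assms by (fastforce simp: admissible_def wf_multigraph_def adjacent_def)+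
  have R: "finite ?R" "card ?R \<le> (card (verts G))\<^sup>2"
    using finite_subset[OF sub] card_mono[OF _ sub] fin
    by (auto simp: card_cartesian_product power2_eq_square)
  have "(r, v) \<in> ?R ^^ depth r G v"
    using relpowp_depth[OF assms] relpowp_relpow_eq[of "depth r G v" ?R] by (simp add: fun_eq_iff)
  then have "(r, v) \<in> ?R\<^sup>*" by (rule relpow_imp_rtrancl)
  then obtain k where "k \<le> card ?R" "(r, v) \<in> ?R ^^ k"
    using rtrancl_finite_eq_relpow[OF R(1)] by auto
  then show ?thesis
    using depth_le[of k G r v] R(2) relpowp_relpow_eq[of k ?R] by (simp add: fun_eq_iff)
qed

lemma admissible_add_edges:
  assumes "admissible r G" "set ps \<subseteq> verts G \<times> verts G"
  shows "admissible r (add_edges ps G)"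
proof -
  have "adjacent G \<le> adjacent (add_edges ps G)"
    by (auto simp: adjacent_def add_edges_def)
  then have "(adjacent (add_edges ps G))\<^sup>*\<^sup>* v w" if "(adjacent G)\<^sup>*\<^sup>* v w" for v w
    using that rtranclp_mono by blast
  then have "connected_graph (add_edges ps G)"
    using assms(1) by (simp add: admissible_def connected_graph_def)
  moreover have "wf_multigraph (add_edges ps G)"
    using assms by (fastforce simp: admissible_def wf_multigraph_def add_edges_def)
  moreover have "edges (add_edges ps G) \<noteq> {#}" "r \<in> verts (add_edges ps G)"
    using assms(1) by (auto simp: admissible_def add_edges_def)
  ultimately show ?thesis by (simp add: admissible_def)
qed

text \<open>Old walks survive when edges are added, so the depths before a step bound those after
  it.\<close>

lemma depth_mono:
  assumes "admissible r G" "v \<in> verts G" "edges G \<subseteq># edges H"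
  shows "depth r H v \<le> depth r G v"
proof (rule depth_le)
  have "adjacent G \<le> adjacent H"
    using assms(3) by (auto simp: adjacent_def dest: mset_subset_eqD)
  then show "(adjacent H ^^ depth r G v) r v"
    using relpowp_depth[OF assms(1,2)] relpowp_mono by (metis predicate2D)
qed

text \<open>A shortest walk to the first sampled vertex extends by one edge to the new vertex. Any
  sampled vertex would do; the first has a convenient law, see
  \<open>nn_integral_replicate_pmf_hd\<close>.\<close>

lemma admissible_join_new_vertex:
  assumes G: "admissible r G" and ws: "set ws \<subseteq> verts G" "ws \<noteq> []"
  shows "admissible r (join_new_vertex ws G)"
    and "depth r (join_new_vertex ws G) (fresh G) \<le> Suc (depth r G (hd ws))"
proof -
  let ?H = "join_new_vertex ws G"
  have le: "adjacent G \<le> adjacent ?H"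
    by (auto simp: adjacent_def join_new_vertex_def)
  have old: "(adjacent ?H ^^ depth r G v) r v" if "v \<in> verts G" for v
    using le relpowp_depth[OF G that] relpowp_mono by (metis predicate2D)
  have hd: "hd ws \<in> verts G" using ws by auto
  have "Upair (hd ws) (fresh G) \<in># edges ?H"
    using ws(2) by (cases ws) (auto simp: join_new_vertex_def Upair_inject)
  then have new: "(adjacent ?H ^^ Suc (depth r G (hd ws))) r (fresh G)"
    using old[OF hd] by (auto simp: adjacent_def)
  then show "depth r ?H (fresh G) \<le> Suc (depth r G (hd ws))" by (rule depth_le)
  have reach: "\<exists>k. (adjacent ?H ^^ k) r v" if "v \<in> verts ?H" for v
    using that old new by (auto simp: join_new_vertex_def simp del: relpowp.simps)
  have "(adjacent ?H)\<^sup>*\<^sup>* v w" if "v \<in> verts ?H" "w \<in> verts ?H" for v w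
    using reach[OF that(1)] reach[OF that(2)]
    by (metis adjacent_relpowp_sym relpowp_imp_rtranclp rtranclp_trans)
  moreover have "wf_multigraph ?H"
    using assms by (fastforce simp: admissible_def wf_multigraph_def join_new_vertex_def)
  ultimately show "admissible r ?H"
    using G by (auto simp: admissible_def connected_graph_def join_new_vertex_def)
qed


section \<open>One step of the process\<close>

lemma nn_integral_replicate_pmf:
  assumes "\<And>w. f w \<ge> 0"
  shows "(\<integral>\<^sup>+ws. ennreal (\<Sum>w\<leftarrow>ws. f w) \<partial>replicate_pmf n q) = of_nat n * (\<integral>\<^sup>+w. ennreal (f w) \<partial>q)"
proof (induction n)
  case (Suc n)
  have "ennreal (f w + (\<Sum>w\<leftarrow>ws. f w)) = ennreal (f w) + ennreal (\<Sum>w\<leftarrow>ws. f w)" for w ws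
    using assms by (intro ennreal_plus sum_list_nonneg) auto
  then show ?case using Suc by (simp add: nn_integral_add algebra_simps)
qed simp

text \<open>The first of at least one independent sample again has law \<open>q\<close>. This yields
  the mean contribution of the new vertex, whose depth is controlled through \<open>hd ws\<close>
  alone.\<close>

lemma nn_integral_replicate_pmf_hd:
  fixes f :: "'b \<Rightarrow> ennreal"
  assumes "n \<ge> 1"
  shows "(\<integral>\<^sup>+ws. f (hd ws) \<partial>replicate_pmf n q) = (\<integral>\<^sup>+w. f w \<partial>q)"
  using assms by (cases n) simp_all

lemma total_weight_ge_2:
  fixes G :: "nat multigraph"
  assumes "admissible r G" "\<delta> \<ge> 0"
  shows "total_weight \<delta> G \<ge> 2"
proof -
  have "size (edges G) \<ge> 1"
    using assms(1) by (simp add: admissible_def Suc_le_eq nonempty_has_size)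
  then have "2 \<le> 2 * real (size (edges G)) + \<delta> * real (card (verts G))"
    using mult_nonneg_nonneg[OF assms(2), of "real (card (verts G))"] by linarith
  then show ?thesis using assms(1) by (simp add: total_weight_eq admissible_def)
qed

lemma pmf_rho_admissible:
  fixes G :: "nat multigraph"
  assumes "admissible r G" "\<delta> \<ge> 0"
  shows "pmf (rho \<delta> G) v =
    (if v \<in> verts G then (real (degree G v) + \<delta>) / total_weight \<delta> G else 0)"
  using assms total_weight_ge_2[OF assms]
  by (subst pmf_rho) (auto simp: weighted_sum_def admissible_def wf_multigraph_def)

lemma set_pmf_rho:
  fixes G :: "nat multigraph"
  assumes "admissible r G" "\<delta> \<ge> 0"
  shows "set_pmf (rho \<delta> G) \<subseteq> verts G"
  using pmf_rho_admissible[OF assms] by (auto simp: set_pmf_eq split: if_splits)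

lemma nn_integral_rho:
  fixes G :: "nat multigraph"
  assumes "admissible r G" "\<delta> \<ge> 0" "\<And>v. \<phi> v \<ge> 0"
  shows "(\<integral>\<^sup>+v. ennreal (\<phi> v) \<partial>rho \<delta> G) = ennreal (weighted_sum \<delta> G \<phi> / total_weight \<delta> G)"
proof -
  have fin: "finite (verts G)" using assms(1) by (simp add: admissible_def wf_multigraph_def)
  have "(\<integral>\<^sup>+v. ennreal (\<phi> v) \<partial>rho \<delta> G) = (\<integral>\<^sup>+v. ennreal (pmf (rho \<delta> G) v) * ennreal (\<phi> v) \<partial>count_space UNIV)"
    by (rule nn_integral_measure_pmf)
  also have "\<dots> = (\<Sum>v\<in>verts G. ennreal (pmf (rho \<delta> G) v) * ennreal (\<phi> v))"
    by (rule nn_integral_count_space'[OF fin]) (auto simp: pmf_rho_admissible[OF assms(1,2)])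
  also have "\<dots> = ennreal (\<Sum>v\<in>verts G. pmf (rho \<delta> G) v * \<phi> v)"
    using assms(3) by (subst sum_ennreal[symmetric]) (simp_all add: ennreal_mult)
  also have "(\<Sum>v\<in>verts G. pmf (rho \<delta> G) v * \<phi> v) = weighted_sum \<delta> G \<phi> / total_weight \<delta> G"
    by (simp add: pmf_rho_admissible[OF assms(1,2)] weighted_sum_def sum_divide_distrib)
  finally show ?thesis .
qed

section \<open>The potential and its supermartingale property\<close>

definition depth_potential :: "real \<Rightarrow> 'v \<Rightarrow> 'v multigraph \<Rightarrow> real" where
  "depth_potential \<delta> r G = weighted_sum \<delta> G (\<lambda>v. 2 ^ depth r G v)"

lemma depth_potential_nonneg: "\<delta> \<ge> 0 \<Longrightarrow> depth_potential \<delta> r G \<ge> 0"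
  unfolding depth_potential_def weighted_sum_def by (intro sum_nonneg) auto

text \<open>Depths can only shrink, so evaluating the new degrees at the old depths gives an upper
  bound that is linear in the sampled vertices.\<close>

lemma depth_potential_add_edges:
  assumes "admissible r G" "\<delta> \<ge> 0" "set ps \<subseteq> verts G \<times> verts G"
  shows "depth_potential \<delta> r (add_edges ps G) \<le>
    depth_potential \<delta> r G + (\<Sum>(a, b)\<leftarrow>ps. 2 ^ depth r G a + 2 ^ depth r G b)"
proof -
  have "depth_potential \<delta> r (add_edges ps G) \<le> weighted_sum \<delta> (add_edges ps G) (\<lambda>v. 2 ^ depth r G v)"
    unfolding depth_potential_def using assms
    by (intro weighted_sum_mono power_increasing depth_mono) (auto simp: add_edges_def)
  also have "\<dots> = depth_potential \<delta> r G + (\<Sum>(a, b)\<leftarrow>ps. 2 ^ depth r G a + 2 ^ depth r G b)"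
    unfolding depth_potential_def using assms
    by (intro weighted_sum_add_edges) (auto simp: admissible_def wf_multigraph_def)
  finally show ?thesis .
qed

lemma depth_potential_join_new_vertex:
  assumes G: "admissible r G" and "\<delta> \<ge> 0" and ws: "set ws \<subseteq> verts G" "ws \<noteq> []"
  shows "depth_potential \<delta> r (join_new_vertex ws G) \<le>
    depth_potential \<delta> r G + (\<Sum>w\<leftarrow>ws. 2 ^ depth r G w)
      + 2 * (real (length ws) + \<delta>) * 2 ^ depth r G (hd ws)"
proof -
  \<comment> \<open>The old exponential weights, extended to the new vertex by the bound from its
    first neighbour; being one level deeper costs the factor 2.\<close>
  define \<phi> :: "nat \<Rightarrow> real" where
    "\<phi> v = (if v = fresh G then 2 * 2 ^ depth r G (hd ws) else 2 ^ depth r G v)" for v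
  have fresh: "fresh G \<notin> verts G"
    using G by (intro fresh_notin) (simp add: admissible_def wf_multigraph_def)
  have "2 ^ depth r (join_new_vertex ws G) v \<le> \<phi> v" if "v \<in> verts (join_new_vertex ws G)" for v
  proof (cases "v = fresh G")
    case True
    have "(2::real) ^ depth r (join_new_vertex ws G) v \<le> 2 ^ Suc (depth r G (hd ws))"
      unfolding True by (intro power_increasing admissible_join_new_vertex[OF G ws]) auto
    then show ?thesis using True by (simp add: \<phi>_def)
  next
    case False
    then have "v \<in> verts G" using that by (simp add: join_new_vertex_def)
    then show ?thesis using False G
      by (auto simp: \<phi>_def join_new_vertex_def intro!: power_increasing depth_mono)
  qed
  then have "depth_potential \<delta> r (join_new_vertex ws G) \<le> weighted_sum \<delta> (join_new_vertex ws G) \<phi>"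
    unfolding depth_potential_def using assms(2) by (intro weighted_sum_mono)
  also have "\<dots> = weighted_sum \<delta> G \<phi> + (real (length ws) + \<delta>) * \<phi> (fresh G) + (\<Sum>w\<leftarrow>ws. \<phi> w)"
    using G ws by (intro weighted_sum_join_new_vertex) (auto simp: admissible_def)
  also have "weighted_sum \<delta> G \<phi> = depth_potential \<delta> r G"
    unfolding depth_potential_def using fresh by (intro weighted_sum_cong) (auto simp: \<phi>_def)
  also have "(\<Sum>w\<leftarrow>ws. \<phi> w) = (\<Sum>w\<leftarrow>ws. 2 ^ depth r G w)"
    using fresh ws by (intro arg_cong[where f = sum_list] map_cong) (auto simp: \<phi>_def)
  finally show ?thesis by (simp add: \<phi>_def algebra_simps)
qed

definition relative_potential :: "real \<Rightarrow> 'v \<Rightarrow> 'v multigraph \<Rightarrow> real" where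
  "relative_potential \<delta> r G = depth_potential \<delta> r G / (total_weight \<delta> G)\<^sup>2"

text \<open>After clearing denominators this is
  \<open>W\<^sup>2 + a * W \<le> (W + b)\<^sup>2\<close>. Here \<open>P / W\<close> is the mean
  exponential weight of a sampled vertex, \<open>a\<close> the number of such means by which the
  potential grows, and \<open>b\<close> the increment of the total weight.\<close>

lemma relative_growth_le:
  fixes P W a b :: real
  assumes "P \<ge> 0" "W > 0" "b \<ge> 0" "a \<le> 2 * b"
  shows "(P + a * (P / W)) / (W + b)\<^sup>2 \<le> P / W\<^sup>2"
proof -
  have "(P + a * (P / W)) * W\<^sup>2 = P * (W\<^sup>2 + a * W)"
    using assms(2) by (simp add: field_simps power2_eq_square)
  also have "\<dots> \<le> P * (W + b)\<^sup>2"
  proof (rule mult_left_mono[OF _ assms(1)])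
    have "a * W \<le> 2 * b * W" using assms by (intro mult_right_mono) auto
    also have "\<dots> \<le> 2 * b * W + b\<^sup>2" by simp
    finally show "W\<^sup>2 + a * W \<le> (W + b)\<^sup>2"
      by (simp add: power2_sum algebra_simps)
  qed
  finally show ?thesis using assms by (simp add: divide_simps ac_simps)
qed

lemma operation_a_supermartingale:
  assumes G: "admissible r G" and \<delta>: "\<delta> \<ge> 0" and x: "x \<ge> 1"
  shows "(\<integral>\<^sup>+H. ennreal (relative_potential \<delta> r H) \<partial>operation_a \<delta> x G)
    \<le> ennreal (relative_potential \<delta> r G)"
proof -
  let ?W = "total_weight \<delta> G" and ?P = "depth_potential \<delta> r G"
  let ?\<phi> = "\<lambda>v. 2 ^ depth r G v :: real"
  \<comment> \<open>The new total weight depends on \<open>x\<close> only and not on the sample, so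
    the denominator is a constant factor of the integral.\<close>
  define c where "c = 1 / (?W + (2 * real x + \<delta>))\<^sup>2"
  have c: "c \<ge> 0" by (simp add: c_def)
  have W: "?W \<ge> 2" by (rule total_weight_ge_2[OF G \<delta>])
  have P: "?P \<ge> 0" by (rule depth_potential_nonneg[OF \<delta>])
  have \<phi>: "(\<integral>\<^sup>+v. ennreal (?\<phi> v) \<partial>rho \<delta> G) = ennreal (?P / ?W)"
    unfolding depth_potential_def by (rule nn_integral_rho[OF G \<delta>]) simp
  have "ennreal (relative_potential \<delta> r (join_new_vertex ws G)) \<le>
      ennreal c * (ennreal ?P + ennreal (\<Sum>w\<leftarrow>ws. ?\<phi> w)
        + ennreal (2 * (real x + \<delta>)) * ennreal (?\<phi> (hd ws)))"
    if "ws \<in> set_pmf (replicate_pmf x (rho \<delta> G))" for ws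
  proof -
    have ws: "set ws \<subseteq> verts G" "length ws = x" "ws \<noteq> []"
      using that set_pmf_rho[OF G \<delta>] x by (auto simp: set_replicate_pmf lists_eq_set)
    have "total_weight \<delta> (join_new_vertex ws G) = ?W + (2 * real x + \<delta>)"
      using weighted_sum_join_new_vertex[OF _ ws(1), of \<delta> "\<lambda>_. 1"] G ws(2)
      by (simp add: admissible_def sum_list_triv)
    then have "relative_potential \<delta> r (join_new_vertex ws G) \<le>
        c * (?P + (\<Sum>w\<leftarrow>ws. ?\<phi> w) + 2 * (real x + \<delta>) * ?\<phi> (hd ws))"
      using depth_potential_join_new_vertex[OF G \<delta> ws(1,3)] ws(2)
      by (simp add: relative_potential_def c_def divide_right_mono)
    then have "ennreal (relative_potential \<delta> r (join_new_vertex ws G)) \<le>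
        ennreal (c * (?P + (\<Sum>w\<leftarrow>ws. ?\<phi> w) + 2 * (real x + \<delta>) * ?\<phi> (hd ws)))"
      by (rule ennreal_leI)
    also have "\<dots> = ennreal c * (ennreal ?P + ennreal (\<Sum>w\<leftarrow>ws. ?\<phi> w)
        + ennreal (2 * (real x + \<delta>)) * ennreal (?\<phi> (hd ws)))"
    proof -
      have "0 \<le> (\<Sum>w\<leftarrow>ws. ?\<phi> w)" by (intro sum_list_nonneg) auto
      then show ?thesis using P \<delta> c
        by (simp add: ennreal_mult ennreal_plus del: distrib_left_numeral)
    qed
    finally show ?thesis .
  qed
  then have "(\<integral>\<^sup>+H. ennreal (relative_potential \<delta> r H) \<partial>operation_a \<delta> x G) \<le>
      (\<integral>\<^sup>+ws. ennreal c * (ennreal ?P + ennreal (\<Sum>w\<leftarrow>ws. ?\<phi> w)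
        + ennreal (2 * (real x + \<delta>)) * ennreal (?\<phi> (hd ws))) \<partial>replicate_pmf x (rho \<delta> G))"
    unfolding operation_a_def by (auto intro!: nn_integral_mono_AE simp: AE_measure_pmf_iff)
  also have "\<dots> = ennreal c * (ennreal ?P + of_nat x * ennreal (?P / ?W)
        + ennreal (2 * (real x + \<delta>)) * ennreal (?P / ?W))"
    using x by (simp add: nn_integral_cmult nn_integral_add nn_integral_replicate_pmf
        nn_integral_replicate_pmf_hd[where f = "\<lambda>v. ennreal (?\<phi> v)"] \<phi> del: distrib_left_numeral)
  also have "\<dots> = ennreal (c * (?P + real x * (?P / ?W) + 2 * (real x + \<delta>) * (?P / ?W)))"
  proof -
    have "ennreal c * (ennreal ?P + of_nat x * ennreal y + ennreal (2 * (real x + \<delta>)) * ennreal y) =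
        ennreal (c * (?P + real x * y + 2 * (real x + \<delta>) * y))" if "y \<ge> 0" for y
      using P \<delta> c that
      by (simp add: ennreal_mult ennreal_plus ennreal_of_nat_eq_real_of_nat del: distrib_left_numeral)
    then show ?thesis using P W by simp
  qed
  \<comment> \<open>Each of the \<open>x\<close> neighbours contributes one mean
    \<open>?P / ?W\<close>, and the new vertex, of weight \<open>x + \<delta>\<close>, twice the
    mean. The total \<open>3 * x + 2 * \<delta>\<close> is at most twice the weight increment
    \<open>2 * x + \<delta>\<close>, as \<open>relative_growth_le\<close> requires.\<close>
  also have "?P + real x * (?P / ?W) + 2 * (real x + \<delta>) * (?P / ?W) =
      ?P + (3 * real x + 2 * \<delta>) * (?P / ?W)"
  proof -
    have "?P + real x * y + 2 * (real x + \<delta>) * y = ?P + (3 * real x + 2 * \<delta>) * y" for y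
      by (simp add: algebra_simps)
    then show ?thesis .
  qed
  also have "ennreal (c * (?P + (3 * real x + 2 * \<delta>) * (?P / ?W))) =
      ennreal ((?P + (3 * real x + 2 * \<delta>) * (?P / ?W)) / (?W + (2 * real x + \<delta>))\<^sup>2)"
    by (simp add: c_def)
  also have "\<dots> \<le> ennreal (relative_potential \<delta> r G)"
    unfolding relative_potential_def using P W \<delta> by (intro ennreal_leI relative_growth_le) auto
  finally show ?thesis .
qed

text \<open>No vertex is added, so the mean gain of the potential is at most \<open>2 * x\<close>
  times the mean \<open>P / W\<close>, while the total weight grows by exactly \<open>2 * x\<close>.
  This is half the relative growth that the square in the denominator allows.\<close>

lemma operation_b_supermartingale:
  assumes G: "admissible r G" and \<delta>: "\<delta> \<ge> 0"
  shows "(\<integral>\<^sup>+H. ennreal (relative_potential \<delta> r H) \<partial>operation_b \<delta> x G)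
    \<le> ennreal (relative_potential \<delta> r G)"
proof -
  let ?W = "total_weight \<delta> G" and ?P = "depth_potential \<delta> r G"
  let ?\<phi> = "\<lambda>v. 2 ^ depth r G v :: real"
  let ?\<psi> = "\<lambda>(a, b). ?\<phi> a + ?\<phi> b" and ?q = "pair_pmf (rho \<delta> G) (rho \<delta> G)"
  define c where "c = 1 / (?W + 2 * real x)\<^sup>2"
  have c: "c \<ge> 0" by (simp add: c_def)
  have W: "?W \<ge> 2" by (rule total_weight_ge_2[OF G \<delta>])
  have P: "?P \<ge> 0" by (rule depth_potential_nonneg[OF \<delta>])
  have \<phi>: "(\<integral>\<^sup>+v. ennreal (?\<phi> v) \<partial>rho \<delta> G) = ennreal (?P / ?W)"
    unfolding depth_potential_def by (rule nn_integral_rho[OF G \<delta>]) simp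
  have \<psi>: "(\<integral>\<^sup>+e. ennreal (?\<psi> e) \<partial>?q) = ennreal (2 * (?P / ?W))"
  proof -
    have "(\<integral>\<^sup>+e. ennreal (?\<psi> e) \<partial>?q) = ennreal (?P / ?W) + ennreal (?P / ?W)"
      by (simp add: nn_integral_pair_pmf' nn_integral_add \<phi>)
    then show ?thesis using P W by (simp flip: ennreal_plus)
  qed
  have sum_\<psi>: "(\<integral>\<^sup>+ps. ennreal (\<Sum>e\<leftarrow>ps. ?\<psi> e) \<partial>replicate_pmf x ?q) = of_nat x * ennreal (2 * (?P / ?W))"
    unfolding \<psi>[symmetric] by (rule nn_integral_replicate_pmf) auto
  have "ennreal (relative_potential \<delta> r (add_edges ps G)) \<le>
      ennreal c * (ennreal ?P + ennreal (\<Sum>e\<leftarrow>ps. ?\<psi> e))"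
    if "ps \<in> set_pmf (replicate_pmf x ?q)" for ps
  proof -
    have ps: "set ps \<subseteq> verts G \<times> verts G" "length ps = x"
      using that set_pmf_rho[OF G \<delta>] by (auto simp: set_replicate_pmf lists_eq_set)
    have "(\<Sum>(a, b)\<leftarrow>ps. 1 + 1 :: real) = 2 * real (length ps)"
      by (induction ps) auto
    then have "total_weight \<delta> (add_edges ps G) = ?W + 2 * real x"
      using weighted_sum_add_edges[OF _ ps(1), of \<delta> "\<lambda>_. 1"] G ps(2)
      by (simp add: admissible_def wf_multigraph_def)
    then have "relative_potential \<delta> r (add_edges ps G) \<le> c * (?P + (\<Sum>e\<leftarrow>ps. ?\<psi> e))"
      using depth_potential_add_edges[OF G \<delta> ps(1)]
      by (simp add: relative_potential_def c_def divide_right_mono)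
    then have "ennreal (relative_potential \<delta> r (add_edges ps G)) \<le>
        ennreal (c * (?P + (\<Sum>e\<leftarrow>ps. ?\<psi> e)))"
      by (rule ennreal_leI)
    also have "\<dots> = ennreal c * (ennreal ?P + ennreal (\<Sum>e\<leftarrow>ps. ?\<psi> e))"
    proof -
      have "0 \<le> (\<Sum>e\<leftarrow>ps. ?\<psi> e)" by (intro sum_list_nonneg) auto
      then show ?thesis using P c by (simp add: ennreal_mult ennreal_plus)
    qed
    finally show ?thesis .
  qed
  then have "(\<integral>\<^sup>+H. ennreal (relative_potential \<delta> r H) \<partial>operation_b \<delta> x G) \<le>
      (\<integral>\<^sup>+ps. ennreal c * (ennreal ?P + ennreal (\<Sum>e\<leftarrow>ps. ?\<psi> e)) \<partial>replicate_pmf x ?q)"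
    unfolding operation_b_def by (auto intro!: nn_integral_mono_AE simp: AE_measure_pmf_iff)
  also have "\<dots> = ennreal c * (ennreal ?P + of_nat x * ennreal (2 * (?P / ?W)))"
    by (simp add: nn_integral_cmult nn_integral_add sum_\<psi>)
  also have "\<dots> = ennreal (c * (?P + real x * (2 * (?P / ?W))))"
  proof -
    have "ennreal c * (ennreal ?P + of_nat x * ennreal y) = ennreal (c * (?P + real x * y))"
      if "y \<ge> 0" for y
      using P c that by (simp add: ennreal_mult ennreal_plus ennreal_of_nat_eq_real_of_nat)
    then show ?thesis using P W by simp
  qed
  also have "\<dots> = ennreal ((?P + 2 * real x * (?P / ?W)) / (?W + 2 * real x)\<^sup>2)"
    by (simp add: c_def field_simps)
  also have "\<dots> \<le> ennreal (relative_potential \<delta> r G)"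
    unfolding relative_potential_def using P W by (intro ennreal_leI relative_growth_le) auto
  finally show ?thesis .
qed

lemma glp_step_supermartingale:
  assumes "admissible r G" "\<delta> \<ge> 0" "x \<ge> 1" "0 \<le> p" "p \<le> 1"
  shows "(\<integral>\<^sup>+H. ennreal (relative_potential \<delta> r H) \<partial>glp_step \<delta> p x G)
    \<le> ennreal (relative_potential \<delta> r G)"
proof -
  have "(\<integral>\<^sup>+H. ennreal (relative_potential \<delta> r H) \<partial>glp_step \<delta> p x G) \<le>
     (\<integral>\<^sup>+b. ennreal (relative_potential \<delta> r G) \<partial>bernoulli_pmf p)"
    unfolding glp_step_def nn_integral_bind_pmf
    using operation_a_supermartingale[OF assms(1-3)] operation_b_supermartingale[OF assms(1,2)]
    by (intro nn_integral_mono) auto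
  then show ?thesis by (simp add: measure_pmf.emeasure_space_1)
qed

text \<open>Holds for every possible outcome, not merely on average. The weight increment of
  operation (a) serves as a common bound for both operations.\<close>

lemma set_pmf_glp_step:
  assumes G: "admissible r G" and \<delta>: "\<delta> \<ge> 0" and x: "x \<ge> 1"
    and H: "H \<in> set_pmf (glp_step \<delta> p x G)"
  shows "admissible r H" "total_weight \<delta> H \<le> total_weight \<delta> G + 2 * real x + \<delta>"
proof -
  have "H \<in> set_pmf (operation_a \<delta> x G) \<or> H \<in> set_pmf (operation_b \<delta> x G)"
    using H by (auto simp: glp_step_def split: if_splits)
  then have "admissible r H \<and> total_weight \<delta> H \<le> total_weight \<delta> G + 2 * real x + \<delta>"
  proof
    assume "H \<in> set_pmf (operation_a \<delta> x G)"
    then obtain ws where ws: "H = join_new_vertex ws G" "set ws \<subseteq> verts G" "length ws = x" "ws \<noteq> []"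
      using set_pmf_rho[OF G \<delta>] x by (fastforce simp: operation_a_def set_replicate_pmf lists_eq_set)
    then show ?thesis
      using admissible_join_new_vertex[OF G ws(2,4)] weighted_sum_join_new_vertex[OF _ ws(2), of \<delta> "\<lambda>_. 1"] G
      by (simp add: admissible_def sum_list_triv)
  next
    assume "H \<in> set_pmf (operation_b \<delta> x G)"
    then obtain ps where ps: "H = add_edges ps G" "set ps \<subseteq> verts G \<times> verts G" "length ps = x"
      using set_pmf_rho[OF G \<delta>] by (fastforce simp: operation_b_def set_replicate_pmf lists_eq_set)
    have "(\<Sum>(a, b)\<leftarrow>ps. 1 + 1 :: real) = 2 * real (length ps)"
      by (induction ps) auto
    then show ?thesis
      using admissible_add_edges[OF G ps(2)] weighted_sum_add_edges[OF _ ps(2), of \<delta> "\<lambda>_. 1"] G ps \<delta>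
      by (simp add: admissible_def wf_multigraph_def)
  qed
  then show "admissible r H" "total_weight \<delta> H \<le> total_weight \<delta> G + 2 * real x + \<delta>" by auto
qed


section \<open>The process\<close>

context glp_model
begin

text \<open>Upgrades the elementary conditional probabilities of the model to integrals of an
  arbitrary \<open>f\<close>: on a history event \<open>E\<close>, given by a representative
  \<open>\<omega>\<^sub>0\<close>, the graph \<open>G t\<close> almost surely takes values in the
  countable support of the step law, and \<open>E\<close> is split along these values.\<close>

lemma nn_integral_on_history:
  fixes \<omega>\<^sub>0 :: 'a and t :: nat
  defines "E \<equiv> {\<omega> \<in> space M. (\<forall>i<t. G i \<omega> = G i \<omega>\<^sub>0) \<and> (\<forall>i\<in>{1..t}. X i \<omega> = X i \<omega>\<^sub>0)}"
  assumes t: "t \<ge> 1"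
  shows "E \<in> sets M"
    and "(\<integral>\<^sup>+\<omega>. f (G t \<omega>) * indicator E \<omega> \<partial>M) =
      emeasure M E * (\<integral>\<^sup>+h. f h \<partial>glp_step \<delta> p (X t \<omega>\<^sub>0) (G (t - 1) \<omega>\<^sub>0))"
proof -
  let ?q = "glp_step \<delta> p (X t \<omega>\<^sub>0) (G (t - 1) \<omega>\<^sub>0)"
  have [measurable]: "G i \<in> measurable M (count_space UNIV)" for i by (rule measurable_G)
  have X [measurable]: "{\<omega> \<in> space M. X i \<omega> = k} \<in> sets M" if "i \<in> {1..t}" for i k
    using measurable_sets[OF measurable_X, of i "{k}"] that
    by (simp add: vimage_def Int_def conj_commute)
  show E [measurable]: "E \<in> sets M"
    unfolding E_def by (intro sets.sets_Collect_conj sets.sets_Collect_finite_All X) measurable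
  define S where "S = set_pmf ?q"
  have S: "countable S" by (simp add: S_def)
  define B where "B h = {\<omega> \<in> space M. G t \<omega> = h} \<inter> E" for h
  have B [measurable]: "B h \<in> sets M" for h by (simp add: B_def)
  show "(\<integral>\<^sup>+\<omega>. f (G t \<omega>) * indicator E \<omega> \<partial>M) = emeasure M E * (\<integral>\<^sup>+h. f h \<partial>?q)"
  \<comment> \<open>On a null history the model prescribes no conditional law, but both sides
    vanish.\<close>
  proof (cases "prob E = 0")
    case True
    then have "AE \<omega> in M. \<omega> \<notin> E" using prob_eq_0[OF E] by simp
    then have "(\<integral>\<^sup>+\<omega>. f (G t \<omega>) * indicator E \<omega> \<partial>M) = (\<integral>\<^sup>+\<omega>. 0 \<partial>M)"
      by (intro nn_integral_cong_AE) (auto elim!: eventually_mono)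
    then show ?thesis using True by (simp add: emeasure_eq_measure)
  next
    case False
    then have pos: "prob E > 0" using measure_nonneg[of M E] by linarith
    have Bh: "emeasure M (B h) = emeasure M E * pmf ?q h" for h
    proof -
      have "\<P>(\<omega> in M. G t \<omega> = h \<bar> (\<forall>i<t. G i \<omega> = G i \<omega>\<^sub>0) \<and> (\<forall>i\<in>{1..t}. X i \<omega> = X i \<omega>\<^sub>0)) = pmf ?q h"
        using step[OF t, of "\<lambda>i. G i \<omega>\<^sub>0" "\<lambda>i. X i \<omega>\<^sub>0" h] pos by (simp add: E_def)
      then have "prob (B h) / prob E = pmf ?q h"
        by (simp add: cond_prob_def B_def E_def Int_def conj_ac)
      then show ?thesis using pos
        by (simp add: emeasure_eq_measure field_simps flip: ennreal_mult)
    qed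
    have disj: "disjoint_family_on B S" by (auto simp: disjoint_family_on_def B_def)
    \<comment> \<open>The step law has full mass on \<open>S\<close>, so by countable additivity the
      pieces \<open>B h\<close> exhaust \<open>E\<close> up to a null set.\<close>
    have "emeasure M (\<Union>h\<in>S. B h) = (\<integral>\<^sup>+h. emeasure M (B h) \<partial>count_space S)"
      using S disj by (intro emeasure_UN_countable) auto
    also have "\<dots> = emeasure M E * emeasure (measure_pmf ?q) S"
      by (simp add: Bh nn_integral_cmult nn_integral_pmf)
    also have "emeasure (measure_pmf ?q) S = 1"
      by (simp add: S_def measure_pmf.emeasure_eq_1_AE AE_measure_pmf)
    finally have "prob (\<Union>h\<in>S. B h) = prob E"
      by (simp add: emeasure_eq_measure)
    moreover have UN: "(\<Union>h\<in>S. B h) \<in> sets M"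
      using S by (intro sets.countable_UN') auto
    ultimately have "prob (E - (\<Union>h\<in>S. B h)) = 0"
      by (subst finite_measure_Diff) (auto simp: B_def)
    then have "AE \<omega> in M. \<omega> \<notin> E - (\<Union>h\<in>S. B h)"
      using UN by (subst (asm) prob_eq_0) auto
    \<comment> \<open>At most one summand is nonzero. Writing the integrand as a sum over the
      countable set \<open>S\<close> allows the sum and the integral to be exchanged.\<close>
    then have "AE \<omega> in M. f (G t \<omega>) * indicator E \<omega> = (\<integral>\<^sup>+h. f h * indicator (B h) \<omega> \<partial>count_space S)"
    proof eventually_elim
      case (elim \<omega>)
      show ?case
      proof (cases "\<omega> \<in> E")
        case True
        then have \<omega>: "G t \<omega> \<in> S" using elim by (auto simp: B_def)
        have "(\<integral>\<^sup>+h. f h * indicator (B h) \<omega> \<partial>count_space S) = (\<Sum>h\<in>{G t \<omega>}. f h * indicator (B h) \<omega>)"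
          using \<omega> by (intro nn_integral_count_space') (auto simp: B_def)
        moreover have "\<omega> \<in> B (G t \<omega>)"
          using True sets.sets_into_space[OF E] by (simp add: B_def subset_iff)
        ultimately show ?thesis using True by simp
      next
        case False
        then show ?thesis by (simp add: B_def)
      qed
    qed
    then have "(\<integral>\<^sup>+\<omega>. f (G t \<omega>) * indicator E \<omega> \<partial>M) =
        (\<integral>\<^sup>+\<omega>. \<integral>\<^sup>+h. f h * indicator (B h) \<omega> \<partial>count_space S \<partial>M)"
      by (rule nn_integral_cong_AE)
    also have "\<dots> = (\<integral>\<^sup>+h. \<integral>\<^sup>+\<omega>. f h * indicator (B h) \<omega> \<partial>M \<partial>count_space S)"
      using S by (intro nn_integral_count_space_nn_integral) auto
    also have "\<dots> = (\<integral>\<^sup>+h. emeasure M E * (ennreal (pmf ?q h) * f h) \<partial>count_space S)"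
      by (simp add: nn_integral_cmult_indicator Bh ac_simps)
    also have "\<dots> = emeasure M E * (\<integral>\<^sup>+h. ennreal (pmf ?q h) * f h \<partial>count_space S)"
      by (simp add: nn_integral_cmult)
    also have "(\<integral>\<^sup>+h. ennreal (pmf ?q h) * f h \<partial>count_space S) = (\<integral>\<^sup>+h. f h \<partial>?q)"
      unfolding nn_integral_measure_pmf S_def
      by (auto simp: nn_integral_count_space_indicator set_pmf_iff split: split_indicator intro!: nn_integral_cong)
    finally show ?thesis .
  qed
qed

text \<open>A one-step bound under the conditional law integrates to a bound on means by summing
  over all histories, of which almost surely only countably many occur since the earlier graphs are
  well-formed.\<close>

lemma nn_integral_step_le:
  assumes t: "t \<ge> 1"
    and wf: "AE \<omega> in M. \<forall>i<t. wf_multigraph (G i \<omega>)"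
    and X: "AE \<omega> in M. X t \<omega> \<in> A"
    and step_le: "\<And>g x. x \<in> A \<Longrightarrow> (\<integral>\<^sup>+h. f' h \<partial>glp_step \<delta> p x g) \<le> f g"
  shows "(\<integral>\<^sup>+\<omega>. f' (G t \<omega>) \<partial>M) \<le> (\<integral>\<^sup>+\<omega>. f (G (t - 1) \<omega>) \<partial>M)"
proof -
  \<comment> \<open>The history consists of the graphs at times 0 to \<open>t - 1\<close> and the
    numbers at times 1 to \<open>t\<close>; thus \<open>X t\<close> is already known while
    \<open>G t\<close> is not.\<close>
  define H where "H \<omega> = (map (\<lambda>i. G i \<omega>) [0..<t], map (\<lambda>i. X i \<omega>) [1..<Suc t])" for \<omega>
  define C where "C = lists {g :: nat multigraph. wf_multigraph g} \<times> (UNIV :: nat list set)"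
  define E where "E c = {\<omega> \<in> space M. H \<omega> = c}" for c
  have C: "countable C"
    unfolding C_def by (intro countable_SIGMA countable_lists countable_wf_multigraphs) auto
  have E_eq: "E (H \<omega>\<^sub>0) = {\<omega> \<in> space M. (\<forall>i<t. G i \<omega> = G i \<omega>\<^sub>0) \<and> (\<forall>i\<in>{1..t}. X i \<omega> = X i \<omega>\<^sub>0)}" for \<omega>\<^sub>0
    by (auto simp: E_def H_def)
  have E [measurable]: "E c \<in> sets M" for c
  proof (cases "c \<in> range H")
    case True
    then obtain \<omega>\<^sub>0 where "c = H \<omega>\<^sub>0" by blast
    then show ?thesis unfolding \<open>c = H \<omega>\<^sub>0\<close> E_eq by (intro nn_integral_on_history(1) t)
  next
    case False
    then have "E c = {}" by (auto simp: E_def)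
    then show ?thesis by simp
  qed
  have [measurable]: "G i \<in> measurable M (count_space UNIV)" for i by (rule measurable_G)
  have decompose: "(\<integral>\<^sup>+\<omega>. k (G i \<omega>) \<partial>M) =
      (\<integral>\<^sup>+c. \<integral>\<^sup>+\<omega>. k (G i \<omega>) * indicator (E c) \<omega> \<partial>M \<partial>count_space C)" for k :: "nat multigraph \<Rightarrow> ennreal" and i
  proof -
    have "AE \<omega> in M. k (G i \<omega>) = (\<integral>\<^sup>+c. k (G i \<omega>) * indicator (E c) \<omega> \<partial>count_space C)"
      using wf AE_space
    proof eventually_elim
      case (elim \<omega>)
      then have "H \<omega> \<in> C" by (auto simp: H_def C_def)
      then have "(\<integral>\<^sup>+c. k (G i \<omega>) * indicator (E c) \<omega> \<partial>count_space C) =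
          (\<Sum>c\<in>{H \<omega>}. k (G i \<omega>) * indicator (E c) \<omega>)"
        by (intro nn_integral_count_space') (auto simp: E_def)
      then show ?case using elim by (simp add: E_def)
    qed
    then have "(\<integral>\<^sup>+\<omega>. k (G i \<omega>) \<partial>M) = (\<integral>\<^sup>+\<omega>. \<integral>\<^sup>+c. k (G i \<omega>) * indicator (E c) \<omega> \<partial>count_space C \<partial>M)"
      by (rule nn_integral_cong_AE)
    also have "\<dots> = (\<integral>\<^sup>+c. \<integral>\<^sup>+\<omega>. k (G i \<omega>) * indicator (E c) \<omega> \<partial>M \<partial>count_space C)"
      using C by (intro nn_integral_count_space_nn_integral borel_measurable_times_ennreal
          measurable_compose[OF measurable_G] borel_measurable_indicator E) auto
    finally show ?thesis .
  qed
  have "(\<integral>\<^sup>+\<omega>. f' (G t \<omega>) * indicator (E c) \<omega> \<partial>M) \<le> (\<integral>\<^sup>+\<omega>. f (G (t - 1) \<omega>) * indicator (E c) \<omega> \<partial>M)" for c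
  proof (cases "\<exists>\<omega>\<^sub>0\<in>E c. X t \<omega>\<^sub>0 \<in> A")
    case True
    then obtain \<omega>\<^sub>0 where \<omega>\<^sub>0: "\<omega>\<^sub>0 \<in> E c" "X t \<omega>\<^sub>0 \<in> A" by blast
    then have c: "c = H \<omega>\<^sub>0" by (simp add: E_def)
    have "(\<integral>\<^sup>+\<omega>. f' (G t \<omega>) * indicator (E c) \<omega> \<partial>M) =
        emeasure M (E c) * (\<integral>\<^sup>+h. f' h \<partial>glp_step \<delta> p (X t \<omega>\<^sub>0) (G (t - 1) \<omega>\<^sub>0))"
      unfolding c E_eq by (rule nn_integral_on_history(2)[OF t])
    also have "\<dots> \<le> emeasure M (E c) * f (G (t - 1) \<omega>\<^sub>0)"
      by (intro mult_left_mono step_le \<omega>\<^sub>0) auto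
    also have "\<dots> = (\<integral>\<^sup>+\<omega>. f (G (t - 1) \<omega>\<^sub>0) * indicator (E c) \<omega> \<partial>M)"
      by (subst nn_integral_cmult_indicator) (auto simp: mult.commute)
    also have "\<dots> = (\<integral>\<^sup>+\<omega>. f (G (t - 1) \<omega>) * indicator (E c) \<omega> \<partial>M)"
      using t by (intro nn_integral_cong) (auto simp: c E_eq split: split_indicator)
    finally show ?thesis .
  next
    case False
    \<comment> \<open>Here \<open>X t\<close> lies outside \<open>A\<close> on the whole history
      event, which is therefore negligible.\<close>
    then have "AE \<omega> in M. f' (G t \<omega>) * indicator (E c) \<omega> = 0"
      using X by (auto elim!: eventually_mono split: split_indicator)
    then have "(\<integral>\<^sup>+\<omega>. f' (G t \<omega>) * indicator (E c) \<omega> \<partial>M) = (\<integral>\<^sup>+\<omega>. 0 \<partial>M)"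
      by (rule nn_integral_cong_AE)
    then show ?thesis by simp
  qed
  then show ?thesis unfolding decompose by (rule nn_integral_mono)
qed

text \<open>Well-formedness of the graphs is derived along the way: \<open>F\<close> is infinite on
  other graphs, so a finite mean excludes them almost surely. A step needs this for all earlier
  times, hence the complete induction.\<close>

lemma nn_integral_supermartingale:
  assumes X: "\<And>t. t \<ge> 1 \<Longrightarrow> AE \<omega> in M. X t \<omega> \<in> A"
    and step_le: "\<And>t g x. x \<in> A \<Longrightarrow> (\<integral>\<^sup>+h. F (Suc t) h \<partial>glp_step \<delta> p x g) \<le> F t g"
    and not_wf: "\<And>t h. \<not> wf_multigraph h \<Longrightarrow> F t h = \<infinity>"
    and finite_start: "F 0 G\<^sub>0 < \<infinity>"
  shows "(\<integral>\<^sup>+\<omega>. F t (G t \<omega>) \<partial>M) \<le> F 0 G\<^sub>0"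
proof (induction t rule: less_induct)
  case (less t)
  have [measurable]: "G i \<in> measurable M (count_space UNIV)" for i by (rule measurable_G)
  have wf: "AE \<omega> in M. wf_multigraph (G i \<omega>)" if "i < t" for i
  proof -
    have "(\<integral>\<^sup>+\<omega>. F i (G i \<omega>) \<partial>M) \<noteq> \<infinity>"
      using less.IH[OF that] finite_start by (metis infinity_ennreal_def leD)
    then have "AE \<omega> in M. F i (G i \<omega>) \<noteq> \<infinity>"
      by (intro nn_integral_PInf_AE measurable_compose[OF measurable_G]) auto
    then show ?thesis using not_wf by (auto elim!: eventually_mono)
  qed
  show ?case
  proof (cases t)
    case 0
    have "(\<integral>\<^sup>+\<omega>. F 0 (G 0 \<omega>) \<partial>M) = (\<integral>\<^sup>+\<omega>. F 0 G\<^sub>0 \<partial>M)"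
      using start by (intro nn_integral_cong_AE) (auto elim!: eventually_mono)
    then show ?thesis by (simp add: 0 emeasure_space_1)
  next
    case (Suc i)
    have "(\<integral>\<^sup>+\<omega>. F (Suc i) (G t \<omega>) \<partial>M) \<le> (\<integral>\<^sup>+\<omega>. F i (G (t - 1) \<omega>) \<partial>M)"
      using wf Suc by (intro nn_integral_step_le[where A = A] X step_le) (auto simp: AE_all_countable)
    also have "\<dots> \<le> F 0 G\<^sub>0" using less.IH[of i] Suc by simp
    finally show ?thesis by (simp add: Suc)
  qed
qed

end


section \<open>The diameter\<close>

text \<open>A shortest walk from the root to \<open>v\<close> has a last edge, which ends at
  \<open>v\<close>. This keeps the weight of \<open>v\<close> at least 1 even for
  \<open>\<delta> = 0\<close>.\<close>

lemma degree_pos: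
  assumes "admissible r G" "v \<in> verts G" "depth r G v > 0"
  shows "degree G v \<ge> 1"
proof -
  obtain k where "depth r G v = Suc k" using assms(3) gr0_implies_Suc by blast
  then have "(adjacent G ^^ Suc k) r v" using relpowp_depth[OF assms(1,2)] by simp
  then obtain w where "Upair w v \<in># edges G" by (auto simp: adjacent_def)
  then have "Upair w v \<in># {#e \<in># edges G. v \<in> set_uprod e#}" by simp
  then have "size {#e \<in># edges G. v \<in> set_uprod e#} \<ge> 1"
    by (metis One_nat_def Suc_leI empty_not_add_mset multi_member_split nonempty_has_size)
  then show ?thesis by (simp add: degree_def)
qed

text \<open>A single vertex deeper than \<open>b\<close> has weight at least 1 and so contributes at
  least \<open>2 powr b\<close> to the potential.\<close>

lemma two_powr_le_relative_potential:
  fixes G :: "nat multigraph"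
  assumes G: "admissible r G" and \<delta>: "\<delta> \<ge> 0" and b: "b \<ge> 0"
    and W: "total_weight \<delta> G \<le> w" and v: "v \<in> verts G" "real (depth r G v) > b"
  shows "2 powr b / w\<^sup>2 \<le> relative_potential \<delta> r G"
proof -
  have fin: "finite (verts G)" using G by (simp add: admissible_def wf_multigraph_def)
  have deg: "degree G v \<ge> 1" using v b by (intro degree_pos[OF G]) auto
  have "2 powr b \<le> 2 powr real (depth r G v)" using v(2) by (intro powr_mono) auto
  also have "\<dots> = 1 * 2 ^ depth r G v" by (simp add: powr_realpow)
  also have "\<dots> \<le> (real (degree G v) + \<delta>) * 2 ^ depth r G v"
    using deg \<delta> by (intro mult_right_mono) auto
  also have "\<dots> \<le> depth_potential \<delta> r G"
    unfolding depth_potential_def weighted_sum_def using fin v(1) \<delta>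
    by (intro member_le_sum) auto
  finally have "2 powr b \<le> depth_potential \<delta> r G" .
  moreover have "2 \<le> total_weight \<delta> G" by (rule total_weight_ge_2[OF G \<delta>])
  ultimately show ?thesis
    unfolding relative_potential_def using W depth_potential_nonneg[OF \<delta>]
    by (intro frac_le power_mono) auto
qed

text \<open>The bound depends on \<open>K\<close> alone and is therefore uniform in
  \<open>n\<close>: all depths are at most \<open>K\<^sup>2\<close>, and a total weight of at least
  1 is at most its square.\<close>

lemma relative_potential_initial:
  fixes G :: "nat multigraph"
  assumes G: "admissible r G" and \<delta>: "\<delta> \<ge> 0" and "card (verts G) \<le> K"
  shows "relative_potential \<delta> r G \<le> 2 ^ K\<^sup>2"
proof -
  have W: "total_weight \<delta> G \<ge> 2" by (rule total_weight_ge_2[OF G \<delta>])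
  have "depth r G v \<le> K\<^sup>2" if "v \<in> verts G" for v
    using depth_le_card_squared[OF G that] power_mono[OF assms(3) le0, of 2] by (rule order_trans)
  then have "depth_potential \<delta> r G \<le> weighted_sum \<delta> G (\<lambda>_. 2 ^ K\<^sup>2 * 1)"
    unfolding depth_potential_def using \<delta> by (intro weighted_sum_mono) (auto intro!: power_increasing)
  also have "\<dots> = 2 ^ K\<^sup>2 * total_weight \<delta> G" by (rule weighted_sum_cmult)
  also have "\<dots> \<le> 2 ^ K\<^sup>2 * (total_weight \<delta> G)\<^sup>2"
    using W by (intro mult_left_mono) (auto simp: power2_eq_square)
  finally show ?thesis unfolding relative_potential_def using W by (simp add: divide_simps)
qed

text \<open>Markov's inequality for the relative potential: a diameter above \<open>2 * b\<close>
  forces a vertex of depth above \<open>b\<close>, hence a large potential. The threshold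
  \<open>b\<close> stays free for later optimisation.\<close>

lemma (in glp_model) prob_large_diameter_le:
  assumes \<delta>: "\<delta> \<ge> 0" and p: "0 \<le> p" "p \<le> 1"
    and K: "card (verts G\<^sub>0) \<le> K"
    and X: "AE \<omega> in M. \<forall>t\<ge>1. 1 \<le> X t \<omega> \<and> X t \<omega> \<le> u"
    and b: "b \<ge> 0"
  shows "prob {\<omega> \<in> space M. \<not> ereal_of_enat (graph_diameter (G n \<omega>)) \<le> ereal (2 * b)} \<le>
    2 ^ K\<^sup>2 * (total_weight \<delta> G\<^sub>0 + real n * (2 * real u + \<delta>))\<^sup>2 / 2 powr b"
proof -
  obtain r where r: "admissible r G\<^sub>0"
    using initial by (auto simp: admissible_def connected_graph_def)
  define w where "w t = total_weight \<delta> G\<^sub>0 + real t * (2 * real u + \<delta>)" for t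
  \<comment> \<open>The value \<open>\<infinity>\<close> outside the reachable graphs makes the bound on the mean also show that
    these graphs are almost surely the only ones that occur.\<close>
  define F where "F t g = (if admissible r g \<and> total_weight \<delta> g \<le> w t
    then ennreal (relative_potential \<delta> r g) else \<infinity>)" for t g
  let ?A = "{1..u}"
  have F_step: "(\<integral>\<^sup>+h. F (Suc t) h \<partial>glp_step \<delta> p x g) \<le> F t g" if x: "x \<in> ?A" for t g x
  proof (cases "admissible r g \<and> total_weight \<delta> g \<le> w t")
    case True
    have "F (Suc t) h = ennreal (relative_potential \<delta> r h)" if "h \<in> set_pmf (glp_step \<delta> p x g)" for h
    proof -
      have "admissible r h" "total_weight \<delta> h \<le> total_weight \<delta> g + 2 * real x + \<delta>"
        using set_pmf_glp_step[OF _ \<delta> _ that] True x by auto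
      moreover have "total_weight \<delta> g + 2 * real x + \<delta> \<le> w (Suc t)"
        using True x by (simp add: w_def algebra_simps)
      ultimately show ?thesis by (simp add: F_def)
    qed
    then have "(\<integral>\<^sup>+h. F (Suc t) h \<partial>glp_step \<delta> p x g) =
        (\<integral>\<^sup>+h. ennreal (relative_potential \<delta> r h) \<partial>glp_step \<delta> p x g)"
      by (intro nn_integral_cong_AE) (simp add: AE_measure_pmf_iff)
    also have "\<dots> \<le> ennreal (relative_potential \<delta> r g)"
      using True x \<delta> p by (intro glp_step_supermartingale) auto
    finally show ?thesis using True by (simp add: F_def)
  next
    case False
    then show ?thesis by (auto simp: F_def)
  qed
  have F0: "F 0 G\<^sub>0 \<le> ennreal (2 ^ K\<^sup>2)"
    using r relative_potential_initial[OF r \<delta> K] by (simp add: F_def w_def ennreal_leI)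
  have mean: "(\<integral>\<^sup>+\<omega>. F n (G n \<omega>) \<partial>M) \<le> F 0 G\<^sub>0"
  proof (rule nn_integral_supermartingale[where A = ?A])
    show "AE \<omega> in M. X t \<omega> \<in> ?A" if "t \<ge> 1" for t
      using X that by (auto elim!: eventually_mono)
    show "F 0 G\<^sub>0 < \<infinity>" using F0 by (simp add: le_less_trans)
    show "F t h = \<infinity>" if "\<not> wf_multigraph h" for t h
      using that by (simp add: F_def admissible_def)
  qed (rule F_step)
  have [measurable]: "G n \<in> measurable M (count_space UNIV)" by (rule measurable_G)
  let ?c = "2 powr b / (w n)\<^sup>2"
  let ?bad = "{\<omega> \<in> space M. \<not> ereal_of_enat (graph_diameter (G n \<omega>)) \<le> ereal (2 * b)}"
  have w: "w n \<ge> 2"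
    using total_weight_ge_2[OF r \<delta>] \<delta> by (simp add: w_def add_increasing2)
  then have c: "?c > 0" by simp
  have "ennreal ?c \<le> F n g" if "\<not> ereal_of_enat (graph_diameter g) \<le> ereal (2 * b)" for g
  proof (cases "admissible r g \<and> total_weight \<delta> g \<le> w n")
    case True
    have "\<exists>v\<in>verts g. real (depth r g v) > b"
    proof (rule ccontr)
      assume "\<not> ?thesis"
      \<comment> \<open>Depths are natural numbers, so the bound \<open>b\<close> can be rounded
        down before \<open>graph_diameter_le\<close> is applied.\<close>
      then have "depth r g v \<le> nat \<lfloor>b\<rfloor>" if "v \<in> verts g" for v
        using that by (simp add: le_nat_floor not_less)
      then have "ereal_of_enat (graph_diameter g) \<le> ereal_of_enat (enat (2 * nat \<lfloor>b\<rfloor>))"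
        using True by (intro iffD2[OF ereal_of_enat_le_iff] graph_diameter_le) auto
      also have "\<dots> = ereal (real (2 * nat \<lfloor>b\<rfloor>))" by simp
      also have "\<dots> \<le> ereal (2 * b)" using b of_nat_floor[of b] by simp
      finally show False using that by simp
    qed
    then have "?c \<le> relative_potential \<delta> r g"
      using True two_powr_le_relative_potential[OF _ \<delta> b] by blast
    then show ?thesis using True by (simp add: F_def ennreal_leI)
  next
    case False
    then show ?thesis by (auto simp: F_def)
  qed
  then have "ennreal ?c * indicator ?bad \<omega> \<le> F n (G n \<omega>)" for \<omega>
    by (auto split: split_indicator)
  then have "(\<integral>\<^sup>+\<omega>. ennreal ?c * indicator ?bad \<omega> \<partial>M) \<le> (\<integral>\<^sup>+\<omega>. F n (G n \<omega>) \<partial>M)"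
    by (rule nn_integral_mono)
  also have "\<dots> \<le> ennreal (2 ^ K\<^sup>2)" using mean F0 by (rule order_trans)
  also have "(\<integral>\<^sup>+\<omega>. ennreal ?c * indicator ?bad \<omega> \<partial>M) = ennreal (?c * prob ?bad)"
    using c by (subst nn_integral_cmult_indicator) (auto simp: emeasure_eq_measure simp flip: ennreal_mult)
  finally have "?c * prob ?bad \<le> 2 ^ K\<^sup>2"
    by (simp add: ennreal_le_iff)
  then show ?thesis unfolding w_def[symmetric] using w by (simp add: field_simps)
qed

theorem theorem3p3:
  fixes r s K :: nat and \<delta> p :: real and l u :: "nat \<Rightarrow> nat"
    and M :: "nat \<Rightarrow> 'a measure" and G\<^sub>0 :: "nat \<Rightarrow> nat multigraph"
    and X :: "nat \<Rightarrow> nat \<Rightarrow> 'a \<Rightarrow> nat" and G :: "nat \<Rightarrow> nat \<Rightarrow> 'a \<Rightarrow> nat multigraph"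
  assumes "s \<ge> 1" and "\<delta> = real r / real s" and "0 \<le> p" and "p \<le> 1"
    and model: "\<And>n. glp_model (M n) \<delta> p (G\<^sub>0 n) (X n) (G n)"
    and initial_size: "\<And>n. card (verts (G\<^sub>0 n)) \<le> K" "\<And>n. size (edges (G\<^sub>0 n)) \<le> K"
    and "\<And>n. l n > 0" and "\<And>n. u n > 0"
    and X_bounds: "\<And>n. AE \<omega> in M n. \<forall>t\<ge>1. l n \<le> X n t \<omega> \<and> X n t \<omega> \<le> u n"
  shows "\<exists>C::real. (\<lambda>n. \<P>(\<omega> in M n. ereal_of_enat (graph_diameter (G n n \<omega>)) \<le>
      ereal (4 * exp 1 * (real (u n) / real (l n) + \<delta> / (2 * real (l n))) * ln (real n)
        + C * real (u n)))) \<longlonglongrightarrow> 1"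
proof (intro exI)
  have \<delta>: "\<delta> \<ge> 0" using assms(2) by simp
  \<comment> \<open>Chosen so that the weight bound at time \<open>n\<close> is at most
    \<open>a * n * u n\<close>: the first two summands bound the initial weight, the others the
    \<open>n\<close> increments.\<close>
  define a where "a = 2 * real K + \<delta> * real K + 2 + \<delta>"
  define B where "B n = 4 * exp 1 * (real (u n) / real (l n) + \<delta> / (2 * real (l n))) * ln (real n)
        + 4 * real (u n)" for n
  define good where "good n = {\<omega> \<in> space (M n). ereal_of_enat (graph_diameter (G n n \<omega>)) \<le> ereal (B n)}" for n
  have lower: "1 - 2 ^ K\<^sup>2 * a\<^sup>2 / real n \<le> measure (M n) (good n)" if n: "n \<ge> 1" for n
  proof -
    interpret glp_model "M n" \<delta> p "G\<^sub>0 n" "X n" "G n" by (rule model)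
    \<comment> \<open>Half the target bound, with the bracket replaced by 1. The logarithmic term
      makes \<open>2 powr b\<close> exceed the factor \<open>n\<close> squared of the squared weight
      with a power of \<open>n\<close> to spare; the term \<open>2 * u n\<close> absorbs the factor
      \<open>u n\<close> squared.\<close>
    define b where "b = 2 * exp 1 * ln (real n) + 2 * real (u n)"
    have ln: "ln (real n) \<ge> 0" using n by simp
    then have b: "b \<ge> 0" by (simp add: b_def)
    have X: "AE \<omega> in M n. \<forall>t\<ge>1. 1 \<le> X n t \<omega> \<and> X n t \<omega> \<le> u n"
      using X_bounds[of n]
    proof eventually_elim
      case (elim \<omega>)
      show ?case
      proof (intro allI impI)
        fix t :: nat assume "t \<ge> 1"
        then have "l n \<le> X n t \<omega> \<and> X n t \<omega> \<le> u n" using elim by blast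
        then show "1 \<le> X n t \<omega> \<and> X n t \<omega> \<le> u n" using assms(8)[of n] by linarith
      qed
    qed
    \<comment> \<open>Both bounds apply to the same value, for instance
      \<open>X n 1 \<omega>\<close>; a statement free of \<open>\<omega>\<close> that holds almost
      surely in a probability space is true.\<close>
    have "AE \<omega> in M n. l n \<le> u n"
      using X_bounds[of n] by eventually_elim (meson order_refl order_trans)
    then have "l n \<le> u n" by simp
    then have "1 \<le> real (u n) / real (l n)" using assms(8)[of n] by simp
    then have "1 \<le> real (u n) / real (l n) + \<delta> / (2 * real (l n))"
      using \<delta> by (simp add: add_increasing2)
    then have "4 * exp 1 * 1 * ln (real n) \<le> 4 * exp 1 * (real (u n) / real (l n) + \<delta> / (2 * real (l n))) * ln (real n)"
      using ln by (intro mult_right_mono mult_left_mono) auto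
    then have bB: "2 * b \<le> B n" by (simp add: b_def B_def)
    let ?bad = "{\<omega> \<in> space (M n). \<not> ereal_of_enat (graph_diameter (G n n \<omega>)) \<le> ereal (2 * b)}"
    let ?w = "total_weight \<delta> (G\<^sub>0 n) + real n * (2 * real (u n) + \<delta>)"
    have [measurable]: "G n n \<in> measurable (M n) (count_space UNIV)" by (rule measurable_G)
    have u1: "1 \<le> real (u n)" and n1: "1 \<le> real n" and nu1: "1 \<le> real n * real (u n)"
      using assms(9)[of n] n mult_mono[of 1 "real n" 1 "real (u n)"] by auto
    have w0: "0 \<le> ?w" using initial(1) \<delta> by (simp add: total_weight_eq)
    have "?w \<le> a * (real n * real (u n))"
    proof -
      have "total_weight \<delta> (G\<^sub>0 n) \<le> 2 * real K + \<delta> * real K"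
        using initial_size[of n] \<delta> initial(1)
        by (simp add: total_weight_eq add_mono mult_left_mono)
      also have "\<dots> \<le> (2 * real K + \<delta> * real K) * (real n * real (u n))"
        using mult_left_mono[OF nu1, of "2 * real K + \<delta> * real K"] \<delta> by simp
      finally have "total_weight \<delta> (G\<^sub>0 n) \<le> (2 * real K + \<delta> * real K) * (real n * real (u n))" .
      moreover have "real n * (2 * real (u n) + \<delta>) \<le> (2 + \<delta>) * (real n * real (u n))"
        using mult_left_mono[OF u1, of "real n * \<delta>"] \<delta> by (simp add: algebra_simps)
      ultimately show ?thesis by (simp add: a_def algebra_simps)
    qed
    then have "?w\<^sup>2 \<le> (a * (real n * real (u n)))\<^sup>2" using w0 by (intro power_mono)
    also have "\<dots> = a\<^sup>2 * ((real n)\<^sup>2 * (real (u n))\<^sup>2)" by (simp add: power_mult_distrib)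
    finally have w2: "?w\<^sup>2 \<le> a\<^sup>2 * ((real n)\<^sup>2 * (real (u n))\<^sup>2)" .
    have b2: "real n ^ 3 * (real (u n))\<^sup>2 \<le> 2 powr b"
    proof -
      \<comment> \<open>The estimates 5/2 for e and 2/3 for ln 2 give 2 e ln 2 at least 10/3, enough
        for the exponent 3.\<close>
      have "(5 / 2 :: real) \<le> exp 1" using exp_lower_Taylor_quadratic[of 1] by simp
      then have "(2 / 3) * (5 / 2) \<le> ln 2 * (exp 1 :: real)"
        using ln2_ge_two_thirds by (intro mult_mono) auto
      then have "3 \<le> ln 2 * (2 * exp 1 :: real)" by simp
      then have "exp (3 * ln (real n)) \<le> exp (ln 2 * (2 * exp 1) * ln (real n))"
        using ln by (simp add: mult_right_mono)
      then have "real n ^ 3 \<le> 2 powr (2 * exp 1 * ln (real n))"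
        using n by (simp add: powr_def exp_of_nat_mult[of 3 "ln (real n)", simplified] ac_simps)
      moreover have "(real (u n))\<^sup>2 \<le> 2 powr (2 * real (u n))"
      proof -
        have "real (u n) \<le> 2 ^ u n" by (simp add: of_nat_less_two_power less_imp_le)
        then have "(real (u n))\<^sup>2 \<le> (2 ^ u n)\<^sup>2" by (intro power_mono) auto
        also have "\<dots> = 2 powr real (2 * u n)"
          by (simp only: powr_realpow power_mult[symmetric] mult.commute)
        finally show ?thesis by simp
      qed
      ultimately show ?thesis unfolding b_def powr_add by (intro mult_mono) auto
    qed
    have "prob ?bad \<le> 2 ^ K\<^sup>2 * ?w\<^sup>2 / 2 powr b"
      using \<delta> assms(3,4) initial_size(1) X b by (rule prob_large_diameter_le)
    also have "\<dots> \<le> 2 ^ K\<^sup>2 * (a\<^sup>2 * ((real n)\<^sup>2 * (real (u n))\<^sup>2)) / (real n ^ 3 * (real (u n))\<^sup>2)"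
      using w2 b2 n1 u1 by (intro frac_le mult_left_mono) auto
    also have "\<dots> = 2 ^ K\<^sup>2 * a\<^sup>2 / real n"
      using n1 u1 by (simp add: field_simps power2_eq_square power3_eq_cube)
    finally have "prob ?bad \<le> 2 ^ K\<^sup>2 * a\<^sup>2 / real n" .
    moreover have "prob (space (M n) - ?bad) = 1 - prob ?bad" by (intro prob_compl) measurable
    moreover have "prob (space (M n) - ?bad) \<le> prob (good n)"
    proof (rule finite_measure_mono)
      show "space (M n) - ?bad \<subseteq> good n"
      proof
        fix \<omega> assume "\<omega> \<in> space (M n) - ?bad"
        then have "\<omega> \<in> space (M n)" "ereal_of_enat (graph_diameter (G n n \<omega>)) \<le> ereal (2 * b)"
          by auto
        moreover have "ereal (2 * b) \<le> ereal (B n)" using bB by simp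
        ultimately show "\<omega> \<in> good n"
          unfolding good_def by (intro CollectI conjI) (assumption, rule order_trans)
      qed
      show "good n \<in> events" unfolding good_def by measurable
    qed
    ultimately show ?thesis by linarith
  qed
  have "(\<lambda>n. measure (M n) (good n)) \<longlonglongrightarrow> 1"
  proof (rule tendsto_sandwich)
    show "(\<lambda>n. 1 - 2 ^ K\<^sup>2 * a\<^sup>2 / real n) \<longlonglongrightarrow> 1"
      by (rule tendsto_eq_rhs[OF tendsto_diff[OF tendsto_const lim_const_over_n]]) simp
    show "\<forall>\<^sub>F n in sequentially. 1 - 2 ^ K\<^sup>2 * a\<^sup>2 / real n \<le> measure (M n) (good n)"
      using lower by (intro eventually_sequentiallyI[of 1])
    show "\<forall>\<^sub>F n in sequentially. measure (M n) (good n) \<le> 1"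
      using model by (simp add: glp_model_def prob_space.prob_le_1)
  qed (rule tendsto_const)
  then show "(\<lambda>n. \<P>(\<omega> in M n. ereal_of_enat (graph_diameter (G n n \<omega>)) \<le>
      ereal (4 * exp 1 * (real (u n) / real (l n) + \<delta> / (2 * real (l n))) * ln (real n)
        + 4 * real (u n)))) \<longlonglongrightarrow> 1"
    unfolding good_def B_def .
qed

end
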